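(* Let $G$ be a connected graph with $n$ vertices, Laplacian matrix $L$, and $\tau(G)$ spanning trees. Then for any two distinct vertices $u,v$ of $G$, $$d_B(u,v)=\frac{\sqrt{\det\big(L^2(u,v\mid u,v)\big)}}{\sqrt n\,\tau(G)},$$ where $L^2(u,v\mid u,v)$ is the $(n-2)\times(n-2)$ matrix obtained from $L^2$ by deleting the rows and columns indexed by $u$ and $v$.
   Context: All graphs are finite, simple and undirected. The Laplacian matrix of $G$ is $L=D-A$ ($A$ adjacency matrix, $D$ diagonal degree matrix). $L^{+}$ is the Moore–Penrose inverse of $L$ and $L^{2+}=(L^{+})^2$. The biharmonic distance is the nonnegative number $d_B(u,v)$ with $d_B^2(u,v)=L^{2+}_{uu}+L^{2+}_{vv}-2L^{2+}_{uv}$. The determinant of a $0\times 0$ matrix is $1$. *)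

theory Defs
  imports "HOL-Analysis.Analysis"
begin

text \<open>
  The vertex set of a graph is a finite type \<open>'v\<close>, so the order of the graph is \<open>CARD('v)\<close>;
  a graph is given by its set of edges, each a two-element set of vertices.
\<close>

definition simple_graph :: "'v::finite set set \<Rightarrow> bool" where
  "simple_graph E \<longleftrightarrow> (\<forall>e\<in>E. card e = 2)"

definition graph_connected :: "'v::finite set set \<Rightarrow> bool" where
  "graph_connected E \<longleftrightarrow> (\<forall>x y. (x, y) \<in> {(a, b). {a, b} \<in> E}\<^sup>*)"

definition is_cycle :: "'v::finite set set \<Rightarrow> 'v list \<Rightarrow> bool" where
  "is_cycle E c \<longleftrightarrow> 3 \<le> length c \<and> distinct c \<and>
     (\<forall>i < length c. {c ! i, c ! ((i + 1) mod length c)} \<in> E)"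

definition is_tree :: "'v::finite set set \<Rightarrow> bool" where
  "is_tree E \<longleftrightarrow> simple_graph E \<and> graph_connected E \<and> \<not> (\<exists>c. is_cycle E c)"

text \<open>A spanning subgraph has all of \<open>'v\<close> as its vertices, so it is just a subset of the edges.\<close>

definition spanning_trees :: "'v::finite set set \<Rightarrow> 'v set set set" where
  "spanning_trees E = {T. T \<subseteq> E \<and> is_tree T}"

definition num_spanning_trees :: "'v::finite set set \<Rightarrow> nat" where
  "num_spanning_trees E = card (spanning_trees E)"

definition vertex_degree :: "'v::finite set set \<Rightarrow> 'v \<Rightarrow> nat" where
  "vertex_degree E v = card {e \<in> E. v \<in> e}"

definition adjacency_matrix :: "'v::finite set set \<Rightarrow> real^'v^'v" where
  "adjacency_matrix E = (\<chi> i j. if {i, j} \<in> E then 1 else 0)"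

definition degree_matrix :: "'v::finite set set \<Rightarrow> real^'v^'v" where
  "degree_matrix E = (\<chi> i j. if i = j then real (vertex_degree E i) else 0)"

definition laplacian :: "'v::finite set set \<Rightarrow> real^'v^'v" where
  "laplacian E = degree_matrix E - adjacency_matrix E"

text \<open>The four Penrose conditions.\<close>

definition is_moore_penrose :: "real^'n^'m \<Rightarrow> real^'m^'n \<Rightarrow> bool" where
  "is_moore_penrose A X \<longleftrightarrow>
     A ** X ** A = A \<and> X ** A ** X = X \<and>
     transpose (A ** X) = A ** X \<and> transpose (X ** A) = X ** A"

definition moore_penrose :: "real^'n^'m \<Rightarrow> real^'m^'n" where
  "moore_penrose A = (THE X. is_moore_penrose A X)"

lemma is_moore_penrose_unique:
  fixes A :: "real^'n^'m" and X Y :: "real^'m^'n"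
  assumes X: "is_moore_penrose A X" and Y: "is_moore_penrose A Y"
  shows "X = Y"
proof -
  note x = X[unfolded is_moore_penrose_def] and y = Y[unfolded is_moore_penrose_def]
  have "A ** X = transpose ((A ** Y) ** (A ** X))"
    using x y by (metis matrix_mul_assoc matrix_transpose_mul)
  also have "\<dots> = transpose (A ** X) ** transpose (A ** Y)"
    by (rule matrix_transpose_mul)
  also have "\<dots> = A ** Y"
    using x y by (metis matrix_mul_assoc)
  finally have AX: "A ** X = A ** Y" .
  have "X ** A = transpose ((X ** A) ** (Y ** A))"
    using x y by (metis matrix_mul_assoc matrix_transpose_mul)
  also have "\<dots> = transpose (Y ** A) ** transpose (X ** A)"
    by (rule matrix_transpose_mul)
  also have "\<dots> = Y ** A"
    using x y by (metis matrix_mul_assoc)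
  finally have XA: "X ** A = Y ** A" .
  have "X = X ** (A ** X)" using x by (metis matrix_mul_assoc)
  also have "\<dots> = Y ** A ** Y" by (metis AX XA matrix_mul_assoc)
  finally show ?thesis using y by simp
qed

text \<open>The radicand is nonnegative, since the square of the pseudoinverse of the (symmetric)
  Laplacian is positive semidefinite; so this is the nonnegative number whose square it is.\<close>

definition biharmonic_distance :: "'v::finite set set \<Rightarrow> 'v \<Rightarrow> 'v \<Rightarrow> real" where
  "biharmonic_distance E u v =
     (let P = moore_penrose (laplacian E) ** moore_penrose (laplacian E)
      in sqrt (P $ u $ u + P $ v $ v - 2 * P $ u $ v))"

text \<open>
  The determinant of the principal submatrix of \<open>A\<close> with rows and columns indexed by \<open>S\<close>.
  The size of this submatrix depends on \<open>S\<close>, so it is not an argument of \<^const>\<open>det\<close>; the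
  formula is that of \<open>det_def\<close> with \<open>S\<close> in place of \<^term>\<open>UNIV\<close>. The lemmas below
  identify it with \<^const>\<open>det\<close> of the submatrix for every indexing of \<open>S\<close> by a type, and
  cover the empty submatrix.
\<close>

definition principal_minor :: "'v::finite set \<Rightarrow> real^'v^'v \<Rightarrow> real" where
  "principal_minor S A =
     (\<Sum>p | p permutes S. of_int (sign p) * (\<Prod>i\<in>S. A $ i $ p i))"

lemma principal_minor_empty: "principal_minor {} A = 1"
  by (simp add: principal_minor_def)

lemma principal_minor_UNIV: "principal_minor UNIV A = det A"
  by (simp add: principal_minor_def det_def)

lemma principal_minor_reindex:
  fixes f :: "'m::finite \<Rightarrow> 'v::finite" and A :: "real^'v^'v"
  assumes f: "bij_betw f UNIV S"
  shows "principal_minor S A = det (\<chi> i j. A $ f i $ f j)"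
proof -
  have inj: "inj f" and S: "S = range f"
    using f by (auto simp: bij_betw_def)
  have "det (\<chi> i j. A $ f i $ f j) =
      (\<Sum>p | p permutes UNIV. of_int (sign p) * (\<Prod>i\<in>UNIV. A $ f i $ f (p i)))"
    by (simp add: det_def)
  also have "\<dots> = (\<Sum>p | p permutes UNIV. of_int (sign (map_permutation UNIV f p)) *
      (\<Prod>i\<in>S. A $ i $ map_permutation UNIV f p i))"
  proof (rule sum.cong, goal_cases)
    case (2 p)
    then have p: "p permutes UNIV" by simp
    have "(\<Prod>i\<in>S. A $ i $ map_permutation UNIV f p i) =
        (\<Prod>i\<in>UNIV. A $ f i $ map_permutation UNIV f p (f i))"
      by (rule prod.reindex_bij_betw[OF f, symmetric])
    then show ?case
      using sign_map_permutation[OF inj p] by (simp add: map_permutation_apply[OF inj])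
  qed simp
  also have "\<dots> = principal_minor S A"
    unfolding principal_minor_def
    using bij_betw_permutations[OF f]
    by (intro sum.reindex_bij_betw) (simp add: map_permutation_def restrict_id_def S)
  finally show ?thesis by simp
qed

text \<open>The determinant of \<open>A(u,v | u,v)\<close>: rows and columns \<open>u\<close> and \<open>v\<close> of \<open>A\<close> are deleted.\<close>

definition det_deleted2 :: "real^'v^'v \<Rightarrow> 'v::finite \<Rightarrow> 'v \<Rightarrow> real" where
  "det_deleted2 A u v = principal_minor (UNIV - {u, v}) A"

end

theory Submission
  imports Defs
begin

text \<open>
  Let \<open>J\<close> be the all-ones matrix, \<open>M = L + J/n\<close> and \<open>x = e\<^sub>u - e\<^sub>v\<close>. Then \<open>M\<close> is invertible with
  \<open>L\<^sup>+ = M\<^sup>-\<^sup>1 - J/n\<close>, so that \<open>d\<^sub>B(u,v)\<^sup>2 = x\<^sup>T N\<^sup>-\<^sup>1 x\<close> for \<open>N = M\<^sup>2 = L\<^sup>2 + J/n\<close>. Because \<open>L\<close>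
  and \<open>L\<^sup>2\<close> have zero row and column sums, \<open>det M = n L(u|u)\<close>, which is \<open>n \<tau>(G)\<close> by the matrix tree
  theorem, and \<open>det (N + x x\<^sup>T) = det N + n L\<^sup>2(u,v|u,v)\<close>. By the matrix determinant lemma
  the left-hand side is \<open>det N (1 + d\<^sub>B(u,v)\<^sup>2)\<close>, where \<open>det N = (n \<tau>(G))\<^sup>2\<close>.

  The matrix tree theorem is proved for all principal minors, which count rooted forests, by
  deleting and contracting an edge that leaves the root set.
\<close>

subsection \<open>Principal minors\<close>

text \<open>A permutation that moves a point outside \<open>S\<close> meets a zero entry of a unit
  row. Padding with unit rows makes row operations on \<open>det\<close> available for principal
  minors.\<close>

lemma principal_minor_eq_det:
  "principal_minor S A = det (\<chi> i j. if i \<in> S then A $ i $ j else if i = j then 1 else 0)"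
proof -
  let ?B = "(\<chi> i j. if i \<in> S then A $ i $ j else if i = j then 1 else 0) :: real^'a^'a"
  have "det ?B = (\<Sum>p | p permutes UNIV. of_int (sign p) * (\<Prod>i\<in>UNIV. ?B $ i $ p i))"
    by (simp add: det_def)
  also have "\<dots> = (\<Sum>p | p permutes S. of_int (sign p) * (\<Prod>i\<in>UNIV. ?B $ i $ p i))"
  proof (rule sum.mono_neutral_right, goal_cases)
    case 1 show ?case by (rule finite_permutations) simp
  next
    case 2 show ?case using permutes_subset[of _ S UNIV] by blast
  next
    case 3
    have "(\<Prod>i\<in>UNIV. ?B $ i $ p i) = 0" if p: "p permutes UNIV" "\<not> p permutes S" for p
    proof -
      obtain i where "i \<notin> S" "p i \<noteq> i"
        using p by (auto simp: permutes_def)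
      then have "?B $ i $ p i = 0" by auto
      then show ?thesis by (meson UNIV_I finite prod_zero)
    qed
    then show ?case by simp
  qed
  also have "\<dots> = principal_minor S A"
    unfolding principal_minor_def
  proof (rule sum.cong, goal_cases)
    case (2 p)
    have "(\<Prod>i\<in>UNIV. ?B $ i $ p i) = (\<Prod>i\<in>S. ?B $ i $ p i)"
      using 2 by (intro prod.mono_neutral_right) (auto simp: permutes_not_in)
    then show ?case by simp
  qed simp
  finally show ?thesis by simp
qed

lemma principal_minor_cong:
  assumes "\<And>i j. i \<in> S \<Longrightarrow> j \<in> S \<Longrightarrow> A $ i $ j = B $ i $ j"
  shows "principal_minor S A = principal_minor S B"
  unfolding principal_minor_def
  using assms by (intro sum.cong refl arg_cong2[of _ _ _ _ "(*)"] prod.cong) (auto simp: permutes_in_image)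

text \<open>Multilinearity of \<open>det\<close> in row \<open>b\<close>: that row is the row of
  \<open>B\<close> plus \<open>t\<close> times a unit row, and a unit row there is exactly the
  padding for \<open>S - {b}\<close>.\<close>

lemma principal_minor_add_diag:
  fixes A B :: "real^'n^'n"
  assumes "b \<in> S"
    and A: "\<And>i j. i \<in> S \<Longrightarrow> j \<in> S \<Longrightarrow> A $ i $ j = B $ i $ j + (if i = b \<and> j = b then t else 0)"
  shows "principal_minor S A = principal_minor S B + t * principal_minor (S - {b}) B"
proof -
  define r where "r i = (if i \<in> S then B $ i else axis i 1)" for i
  let ?A = "(\<chi> i j. B $ i $ j + (if i = b \<and> j = b then t else 0)) :: real^'n^'n"
  have "principal_minor S A = principal_minor S ?A"
    using A by (intro principal_minor_cong) auto
  also have "\<dots> = det ((\<chi> i. if i = b then B $ b + t *s axis b 1 else r i) :: real^'n^'n)"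
    unfolding principal_minor_eq_det using \<open>b \<in> S\<close>
    by (intro arg_cong[of _ _ det]) (auto simp: vec_eq_iff r_def axis_def)
  also have "\<dots> = det ((\<chi> i. if i = b then B $ b else r i) :: real^'n^'n)
      + t * det ((\<chi> i. if i = b then axis b 1 else r i) :: real^'n^'n)"
    by (simp add: det_row_add det_row_mul)
  also have "\<dots> = principal_minor S B + t * principal_minor (S - {b}) B"
    unfolding principal_minor_eq_det using \<open>b \<in> S\<close>
    by (intro arg_cong2[of _ _ _ _ "(+)"] arg_cong2[of _ _ _ _ "(*)"] arg_cong[of _ _ det])
      (auto simp: vec_eq_iff r_def axis_def)
  finally show ?thesis .
qed

lemma principal_minor_singleton: "principal_minor {u} A = A $ u $ u"
proof -
  have "{p. p permutes {u}} = {id}" by (auto simp: permutes_sing)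
  then show ?thesis by (simp add: principal_minor_def sign_id)
qed

lemma principal_minor_doubleton:
  assumes "u \<noteq> v"
  shows "principal_minor {u, v} A = A $ u $ u * A $ v $ v - A $ u $ v * A $ v $ u"
proof -
  define f :: "2 \<Rightarrow> _" where "f i = (if i = 1 then u else v)" for i
  have "bij_betw f UNIV {u, v}"
    using assms by (auto simp: bij_betw_def inj_on_def f_def UNIV_2)
  then show ?thesis
    by (simp add: principal_minor_reindex det_2 f_def)
qed

subsection \<open>The matrix tree theorem\<close>

abbreviation adj_rel :: "'v set set \<Rightarrow> ('v \<times> 'v) set" where
  "adj_rel T \<equiv> {(a, b). {a, b} \<in> T}"

definition reaches :: "'v set set \<Rightarrow> 'v set \<Rightarrow> bool" where
  "reaches T R \<longleftrightarrow> (\<forall>x. \<exists>y\<in>R. (x, y) \<in> (adj_rel T)\<^sup>*)"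

text \<open>A walk about to use the deleted edge stands at \<open>a\<close> or \<open>b\<close>.
  Both are now roots, so it can stop there.\<close>

lemma reaches_delete_edge:
  assumes "reaches T R" "a \<in> R"
  shows "reaches (T - {{a, b}}) (insert b R)"
  unfolding reaches_def
proof
  fix x
  obtain y where "y \<in> R" "(x, y) \<in> (adj_rel T)\<^sup>*"
    using assms by (auto simp: reaches_def)
  from this(2) show "\<exists>z\<in>insert b R. (x, z) \<in> (adj_rel (T - {{a, b}}))\<^sup>*"
  proof (induction rule: converse_rtrancl_induct)
    case base
    then show ?case using \<open>y \<in> R\<close> by blast
  next
    case (step x x')
    show ?case
    proof (cases "{x, x'} = {a, b}")
      case True
      then have "x \<in> insert b R" using \<open>a \<in> R\<close> by (auto simp: doubleton_eq_iff)
      then show ?thesis by blast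
    next
      case False
      with step have "(x, x') \<in> adj_rel (T - {{a, b}})" by simp
      with step.IH show ?thesis by (meson converse_rtrancl_into_rtrancl)
    qed
  qed
qed

lemma reaches_insert_edge:
  assumes T: "reaches T (insert b R)" and "a \<in> R"
  shows "reaches (insert {a, b} T) R"
  unfolding reaches_def
proof
  fix x
  have mono: "(adj_rel T)\<^sup>* \<subseteq> (adj_rel (insert {a, b} T))\<^sup>*"
    by (rule rtrancl_mono) auto
  obtain y where y: "y \<in> insert b R" "(x, y) \<in> (adj_rel (insert {a, b} T))\<^sup>*"
    using T mono unfolding reaches_def by blast
  have "(b, a) \<in> adj_rel (insert {a, b} T)" by (simp add: insert_commute)
  then show "\<exists>y\<in>R. (x, y) \<in> (adj_rel (insert {a, b} T))\<^sup>*"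
    using y \<open>a \<in> R\<close> by (blast intro: rtrancl.rtrancl_into_rtrancl)
qed

lemma reaches_crossing_edge:
  assumes "reaches T R" "x \<notin> R"
  obtains a b where "a \<in> R" "b \<notin> R" "{a, b} \<in> T"
proof -
  obtain y where "y \<in> R" "(x, y) \<in> (adj_rel T)\<^sup>*"
    using assms by (auto simp: reaches_def)
  from this(2) assms(2) have "\<exists>a b. a \<in> R \<and> b \<notin> R \<and> {a, b} \<in> T"
  proof (induction rule: converse_rtrancl_induct)
    case base
    then show ?case using \<open>y \<in> R\<close> by blast
  next
    case (step x x')
    then show ?case by (cases "x' \<in> R") (auto simp: insert_commute)
  qed
  then show ?thesis using that by blast
qed

text \<open>Acyclicity is encoded by the edge count: a spanning subgraph in which every vertex is
  joined to \<open>R\<close> has at least \<open>CARD('v) - card R\<close> edges, with equality iff it is a forest with exactly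
  one vertex of \<open>R\<close> in each component. In this form deletion and contraction of an edge leaving
  \<open>R\<close> both stay within simple graphs: contracting \<open>{a, b}\<close> just makes \<open>b\<close> a further root.\<close>

definition rooted_forests :: "'v::finite set set \<Rightarrow> 'v set \<Rightarrow> 'v set set set" where
  "rooted_forests E R = {T. T \<subseteq> E \<and> card T + card R = CARD('v) \<and> reaches T R}"

text \<open>Forests avoiding \<open>e\<close> give the first summand. Those containing
  \<open>e\<close> lose one edge while \<open>b\<close> becomes a root, so the count condition is
  kept and \<open>insert e\<close> undoes the removal.\<close>

lemma rooted_forests_delete_contract:
  fixes E :: "'v::finite set set"
  assumes e: "e = {a, b}" "e \<in> E" and ab: "a \<in> R" "b \<notin> R"
  shows "card (rooted_forests E R) =
    card (rooted_forests (E - {e}) R) + card (rooted_forests (E - {e}) (insert b R))"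
proof -
  have *: "rooted_forests E R =
      rooted_forests (E - {e}) R \<union> insert e ` rooted_forests (E - {e}) (insert b R)"
    (is "?A = ?B \<union> insert e ` ?C")
  proof (intro equalityI subsetI)
    fix T assume T: "T \<in> ?A"
    show "T \<in> ?B \<union> insert e ` ?C"
    proof (cases "e \<in> T")
      case False
      with T show ?thesis by (auto simp: rooted_forests_def)
    next
      case True
      have "card T = Suc (card (T - {e}))" using True by (intro card.remove) auto
      then have "T - {e} \<in> ?C"
        using T ab e reaches_delete_edge[of T R a b]
        by (auto simp: rooted_forests_def simp del: card_Diff_insert)
      moreover have "T = insert e (T - {e})" using True by auto
      ultimately show ?thesis by blast
    qed
  next
    fix T assume "T \<in> ?B \<union> insert e ` ?C"
    then show "T \<in> ?A"
    proof
      assume "T \<in> ?B"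
      then show ?thesis by (auto simp: rooted_forests_def)
    next
      assume "T \<in> insert e ` ?C"
      then obtain T' where T': "T' \<in> ?C" "T = insert e T'" by blast
      then have "e \<notin> T'" by (auto simp: rooted_forests_def)
      then have "card T = Suc (card T')" using T' by simp
      then show ?thesis
        using T' e ab reaches_insert_edge[of T' b R a]
        by (auto simp: rooted_forests_def)
    qed
  qed
  have "inj_on (insert e) ?C"
    by (rule inj_onI) (auto simp: rooted_forests_def)
  then have "card (insert e ` ?C) = card ?C" by (rule card_image)
  moreover have "?B \<inter> insert e ` ?C = {}" by (auto simp: rooted_forests_def)
  ultimately show ?thesis
    unfolding * by (subst card_Un_disjoint) auto
qed

text \<open>Induction on the number of non-roots: a crossing edge is deleted and its outer end made
  a root, so the contraction term of the recursion is positive.\<close>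

lemma rooted_forest_exists:
  fixes T :: "'v::finite set set"
  assumes "reaches T R"
  shows "rooted_forests T R \<noteq> {}"
  using assms
proof (induction "card (- R)" arbitrary: R T)
  case 0
  then have "R = UNIV" by auto
  then show ?case by (auto simp: rooted_forests_def reaches_def intro!: exI[of _ "{}"])
next
  case (Suc k)
  then obtain x where "x \<notin> R" by (metis Compl_iff card.empty ex_in_conv nat.distinct(1))
  with Suc.prems obtain a b where ab: "a \<in> R" "b \<notin> R" "{a, b} \<in> T"
    by (blast elim: reaches_crossing_edge)
  have "k = card (- insert b R)"
    using Suc.hyps(2) ab(2) by (simp add: Compl_insert card_Diff_singleton)
  then have "rooted_forests (T - {{a, b}}) (insert b R) \<noteq> {}"
    by (rule Suc.hyps(1)) (rule reaches_delete_edge[OF Suc.prems ab(1)])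
  then have "card (rooted_forests (T - {{a, b}}) (insert b R)) > 0"
    by (simp add: card_gt_0_iff)
  then have "card (rooted_forests T R) > 0"
    using rooted_forests_delete_contract[OF refl ab(3,1,2)] by linarith
  then show ?case by (simp add: card_gt_0_iff)
qed

section \<open>Laplacian minors as forest counts\<close>

lemma vertex_degree_eq_sum:
  fixes E :: "'v::finite set set"
  assumes "simple_graph E"
  shows "real (vertex_degree E i) = (\<Sum>j\<in>UNIV. if {i, j} \<in> E then 1 else 0)"
proof -
  have "bij_betw (\<lambda>j. {i, j}) {j. {i, j} \<in> E} {e \<in> E. i \<in> e}"
  proof (rule bij_betwI', goal_cases)
    case (3 e)
    with assms have "card e = 2" by (auto simp: simple_graph_def)
    with 3 show ?case by (auto simp: card_2_iff insert_commute)
  qed (auto simp: doubleton_eq_iff)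
  then show ?thesis
    by (simp add: vertex_degree_def bij_betw_same_card[symmetric] sum.If_cases)
qed

lemma laplacian_nth:
  "laplacian E $ i $ j = (if i = j then real (vertex_degree E i) else 0) - (if {i, j} \<in> E then 1 else 0)"
  by (simp add: laplacian_def degree_matrix_def adjacency_matrix_def)

lemma laplacian_sum_eq_0:
  fixes E :: "'v::finite set set"
  assumes "simple_graph E" "i \<in> S" "\<And>j. j \<notin> S \<Longrightarrow> {i, j} \<notin> E"
  shows "(\<Sum>j\<in>S. laplacian E $ i $ j) = 0"
proof -
  have "(\<Sum>j\<in>S. laplacian E $ i $ j) = real (vertex_degree E i) - (\<Sum>j\<in>S. if {i, j} \<in> E then 1 else 0)"
    using assms(2) by (simp add: laplacian_nth sum_subtractf)
  also have "(\<Sum>j\<in>S. if {i, j} \<in> E then 1 else 0) = (\<Sum>j\<in>UNIV. if {i, j} \<in> E then 1 else (0::real))"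
    using assms(3) by (intro sum.mono_neutral_left) auto
  finally show ?thesis using assms(1) by (simp add: vertex_degree_eq_sum)
qed

text \<open>Deleting an edge from a root to a non-root \<open>b\<close> changes only the diagonal
  entry at \<open>b\<close> of the non-root block, so both sides obey the same recursion. If there
  is no such edge, either all vertices are roots and both sides are 1, or both sides vanish.\<close>

lemma principal_minor_laplacian:
  fixes E :: "'v::finite set set"
  assumes "simple_graph E"
  shows "principal_minor (- R) (laplacian E) = real (card (rooted_forests E R))"
  using assms
proof (induction "card E" arbitrary: E R rule: less_induct)
  case less
  consider "R = UNIV" | a b where "a \<in> R" "b \<notin> R" "{a, b} \<in> E"
    | x where "x \<notin> R" "\<forall>a b. a \<in> R \<longrightarrow> b \<notin> R \<longrightarrow> {a, b} \<notin> E"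
    by blast
  then show ?case
  proof cases
    case 1
    then have "rooted_forests E R = {{}}" by (auto simp: rooted_forests_def reaches_def)
    with 1 show ?thesis by (simp add: principal_minor_empty)
  next
    case (2 a b)
    define e where "e = {a, b}"
    have simple: "simple_graph (E - {e})" and less': "card (E - {e}) < card E"
      using less.prems 2 card_Diff1_less[of E e] by (auto simp: simple_graph_def e_def)
    have deg: "vertex_degree E i = vertex_degree (E - {e}) i + (if i = b then 1 else 0)"
      if "i \<notin> R" for i
    proof (cases "i = b")
      case True
      have "{f \<in> E. b \<in> f} = insert e {f \<in> E - {e}. b \<in> f}" using 2 by (auto simp: e_def)
      then show ?thesis using True by (simp add: vertex_degree_def)
    next
      case False
      then have "{f \<in> E. i \<in> f} = {f \<in> E - {e}. i \<in> f}" using that 2 by (auto simp: e_def)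
      then show ?thesis using False by (simp add: vertex_degree_def)
    qed
    have "principal_minor (- R) (laplacian E) = principal_minor (- R) (laplacian (E - {e}))
        + 1 * principal_minor (- R - {b}) (laplacian (E - {e}))"
      using 2 by (intro principal_minor_add_diag)
        (auto simp: laplacian_nth deg e_def doubleton_eq_iff)
    also have "- R - {b} = - insert b R" by auto
    finally show ?thesis
      using less.hyps[OF less' simple] 2 by (simp add: rooted_forests_delete_contract[OF e_def, of E R] e_def)
  next
    case (3 x)
    define A :: "real^'v^'v" where
      "A = (\<chi> i j. if i \<in> - R then laplacian E $ i $ j else if i = j then 1 else 0)"
    \<comment> \<open>The indicator of the non-roots is a kernel vector: no edge joins them to
      \<open>R\<close>, so their Laplacian rows already sum to zero over \<open>- R\<close>.\<close>
    define w :: "real^'v" where "w = (\<chi> i. if i \<in> R then 0 else 1)"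
    have "(A *v w) $ i = 0" for i
    proof (cases "i \<in> R")
      case True
      then show ?thesis by (auto simp: A_def matrix_vector_mult_def w_def intro!: sum.neutral)
    next
      case False
      have "(A *v w) $ i = (\<Sum>j\<in>UNIV. if j \<in> - R then laplacian E $ i $ j else 0)"
        using False by (auto simp: A_def matrix_vector_mult_def w_def intro!: sum.cong)
      also have "\<dots> = (\<Sum>j\<in>- R. laplacian E $ i $ j)"
        by (simp add: sum.If_cases Compl_eq)
      also have "\<dots> = 0"
        using 3 False less.prems by (intro laplacian_sum_eq_0) (auto simp: insert_commute)
      finally show ?thesis .
    qed
    then have "A *v w = 0" by (simp add: vec_eq_iff)
    moreover have "w \<noteq> 0" using 3 by (auto simp: vec_eq_iff w_def)
    ultimately have "\<not> invertible A"
      using matrix_left_invertible_ker[of A] unfolding invertible_def by blast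
    then have "principal_minor (- R) (laplacian E) = 0"
      unfolding principal_minor_eq_det A_def by (simp add: invertible_det_nz)
    moreover have "rooted_forests E R = {}"
      using 3 reaches_crossing_edge[of _ R x] unfolding rooted_forests_def by blast
    ultimately show ?thesis by simp
  qed
qed

section \<open>Spanning trees as forests with one root\<close>

lemma graph_connected_iff_reaches:
  "graph_connected T \<longleftrightarrow> reaches T {r}"
proof
  assume "reaches T {r}"
  then have r: "(x, r) \<in> (adj_rel T)\<^sup>*" for x by (auto simp: reaches_def)
  have "sym ((adj_rel T)\<^sup>*)" by (intro sym_rtrancl) (auto simp: sym_def insert_commute)
  then show "graph_connected T"
    unfolding graph_connected_def using r by (meson rtrancl_trans symD)
qed (auto simp: reaches_def graph_connected_def)

lemma card_connected_ge:
  fixes T :: "'v::finite set set"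
  assumes "graph_connected T"
  shows "CARD('v) \<le> card T + 1"
proof -
  \<comment> \<open>Any vertex can serve as the root; \<open>undefined\<close> is just some
    vertex.\<close>
  obtain T' where "T' \<in> rooted_forests T {undefined}"
    using assms rooted_forest_exists graph_connected_iff_reaches by blast
  then have "T' \<subseteq> T" "card T' + 1 = CARD('v)" by (auto simp: rooted_forests_def)
  then show ?thesis by (metis add_le_mono1 card_mono finite)
qed

text \<open>A new first vertex is prepended, unless it already lies on the path; then everything
  before its occurrence is dropped.\<close>

lemma rtrancl_distinct_path:
  assumes "(x, y) \<in> r\<^sup>*"
  obtains p where "p \<noteq> []" "hd p = x" "last p = y" "distinct p"
    "\<And>i. Suc i < length p \<Longrightarrow> (p ! i, p ! Suc i) \<in> r"
proof -
  have "\<exists>p. p \<noteq> [] \<and> hd p = x \<and> last p = y \<and> distinct p \<and>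
      (\<forall>i. Suc i < length p \<longrightarrow> (p ! i, p ! Suc i) \<in> r)"
    using assms
  proof (induction rule: converse_rtrancl_induct)
    case base
    then show ?case by (intro exI[of _ "[y]"]) auto
  next
    case (step x x')
    then obtain p where p: "p \<noteq> []" "hd p = x'" "last p = y" "distinct p"
      and r: "\<And>i. Suc i < length p \<Longrightarrow> (p ! i, p ! Suc i) \<in> r" by blast
    show ?case
    proof (cases "x \<in> set p")
      case True
      then obtain k where k: "k < length p" "p ! k = x" by (auto simp: in_set_conv_nth)
      then show ?thesis
        using p r by (intro exI[of _ "drop k p"]) (auto simp: hd_drop_conv_nth)
    next
      case False
      have "((x # p) ! i, (x # p) ! Suc i) \<in> r" if "Suc i < length (x # p)" for i
        using that p(1,2) r step(1) by (cases i) (auto simp: hd_conv_nth)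
      then show ?thesis
        using p False by (intro exI[of _ "x # p"]) auto
    qed
  qed
  then show ?thesis using that by blast
qed

text \<open>The rest of the cycle is a detour around its closing edge.\<close>

lemma connected_delete_cycle_edge:
  assumes T: "graph_connected T" and c: "is_cycle T c"
  shows "graph_connected (T - {{c ! 0, c ! (length c - 1)}})"
proof -
  define n where "n = length c"
  define f where "f = {c ! 0, c ! (n - 1)}"
  let ?r = "adj_rel (T - {f})"
  have n: "3 \<le> n" "distinct c" and cE: "\<And>i. i < n \<Longrightarrow> {c ! i, c ! (Suc i mod n)} \<in> T"
    using c by (auto simp: is_cycle_def n_def)
  have path: "(c ! 0, c ! i) \<in> ?r\<^sup>*" if "i < n" for i
    using that
  proof (induction i)
    case (Suc i)
    then have "{c ! i, c ! Suc i} \<in> T" using cE[of i] by simp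
    \<comment> \<open>Consecutive positions could form the closing edge only in a cycle of two
      vertices.\<close>
    moreover have "{c ! i, c ! Suc i} \<noteq> f"
    proof
      assume "{c ! i, c ! Suc i} = f"
      then have "i = 0 \<and> Suc i = n - 1 \<or> i = n - 1 \<and> Suc i = 0"
        using Suc.prems n by (simp add: f_def doubleton_eq_iff nth_eq_iff_index_eq flip: n_def)
      then show False using Suc.prems n(1) by auto
    qed
    ultimately show ?case using Suc by (auto intro: rtrancl.rtrancl_into_rtrancl)
  qed simp
  have "sym (?r\<^sup>*)" by (intro sym_rtrancl) (auto simp: sym_def insert_commute)
  then have f: "(a, b) \<in> ?r\<^sup>*" if "{a, b} = f" for a b
    using that path[of "n - 1"] n by (auto simp: f_def doubleton_eq_iff dest: symD)
  have "adj_rel T \<subseteq> ?r\<^sup>*" using f by auto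
  then have "(adj_rel T)\<^sup>* \<subseteq> ?r\<^sup>*" by (rule rtrancl_subset_rtrancl)
  then show ?thesis using T unfolding graph_connected_def f_def n_def by blast
qed

text \<open>A path from \<open>x\<close> to \<open>y\<close> inside \<open>T'\<close> without
  repeated vertices closes up with the edge \<open>{x, y}\<close>.\<close>

lemma cycle_from_redundant_edge:
  assumes "graph_connected T'" "T' \<subseteq> T" "{x, y} \<in> T - T'" "x \<noteq> y"
  shows "\<exists>c. is_cycle T c"
proof -
  have "(x, y) \<in> (adj_rel T')\<^sup>*" using assms(1) by (simp add: graph_connected_def)
  then obtain p where p: "p \<noteq> []" "hd p = x" "last p = y" "distinct p"
    and r: "\<And>i. Suc i < length p \<Longrightarrow> (p ! i, p ! Suc i) \<in> adj_rel T'"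
    by (rule rtrancl_distinct_path) blast
  have p0: "p ! 0 = x" and pl: "p ! (length p - 1) = y"
    using p by (auto simp: hd_conv_nth last_conv_nth)
  have "length p \<noteq> 0" "length p \<noteq> 1" using p p0 pl \<open>x \<noteq> y\<close> by auto
  \<comment> \<open>A path on two vertices would be the edge \<open>{x, y}\<close> itself, which is
    not in \<open>T'\<close>.\<close>
  moreover have "length p \<noteq> 2"
  proof
    assume "length p = 2"
    then show False using r[of 0] p0 pl assms(3) by auto
  qed
  ultimately have "3 \<le> length p" by linarith
  moreover have "{p ! i, p ! ((i + 1) mod length p)} \<in> T" if "i < length p" for i
  proof (cases "Suc i = length p")
    case True
    then have "i = length p - 1" by simp
    then show ?thesis using p0 pl True assms(3) by (auto simp: insert_commute)
  next
    case False
    then show ?thesis using that r[of i] assms(2) by auto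
  qed
  ultimately show ?thesis using p(4) unfolding is_cycle_def by blast
qed

text \<open>A tree contains a forest rooted at \<open>r\<close>, and any edge beyond it would close
  a cycle. Conversely, deleting an edge of a cycle would leave a connected graph with too few
  edges.\<close>

lemma spanning_trees_eq_rooted_forests:
  fixes E :: "'v::finite set set"
  assumes E: "simple_graph E"
  shows "spanning_trees E = rooted_forests E {r}"
proof (intro equalityI subsetI)
  fix T assume "T \<in> spanning_trees E"
  then have T: "T \<subseteq> E" "simple_graph T" "graph_connected T" "\<not> (\<exists>c. is_cycle T c)"
    by (auto simp: spanning_trees_def is_tree_def)
  then obtain T' where T': "T' \<in> rooted_forests T {r}"
    using rooted_forest_exists graph_connected_iff_reaches by blast
  then have conn: "graph_connected T'" "T' \<subseteq> T"
    by (auto simp: rooted_forests_def graph_connected_iff_reaches[of _ r])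
  have "T' = T"
  proof (rule ccontr)
    assume "T' \<noteq> T"
    then obtain f where f: "f \<in> T - T'" using conn by blast
    then obtain x y where "f = {x, y}" "x \<noteq> y"
      using T(2) by (force simp: simple_graph_def card_2_iff)
    then show False using cycle_from_redundant_edge[OF conn] f T(4) by blast
  qed
  then show "T \<in> rooted_forests E {r}" using T' T(1) by (auto simp: rooted_forests_def)
next
  fix T assume "T \<in> rooted_forests E {r}"
  then have T: "T \<subseteq> E" "card T + 1 = CARD('v)" "graph_connected T"
    by (auto simp: rooted_forests_def graph_connected_iff_reaches[of _ r])
  have False if c: "is_cycle T c" for c
  proof -
    let ?f = "{c ! 0, c ! (length c - 1)}"
    have "length c - 1 < length c" "Suc (length c - 1) = length c"
      using c by (auto simp: is_cycle_def)
    moreover have "\<And>i. i < length c \<Longrightarrow> {c ! i, c ! (Suc i mod length c)} \<in> T"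
      using c by (simp add: is_cycle_def)
    ultimately have "?f \<in> T" by (metis insert_commute mod_self)
    then have "card T = Suc (card (T - {?f}))" by (intro card.remove) auto
    moreover have "CARD('v) \<le> card (T - {?f}) + 1"
      by (rule card_connected_ge[OF connected_delete_cycle_edge[OF T(3) c]])
    ultimately show False using T(2) by linarith
  qed
  moreover have "simple_graph T" using T(1) E by (auto simp: simple_graph_def)
  ultimately show "T \<in> spanning_trees E" using T by (auto simp: spanning_trees_def is_tree_def)
qed

lemma matrix_tree:
  assumes "simple_graph E"
  shows "principal_minor (- {r}) (laplacian E) = real (num_spanning_trees E)"
  using assms
  by (simp add: principal_minor_laplacian num_spanning_trees_def spanning_trees_eq_rooted_forests[of _ r])

lemma num_spanning_trees_pos:
  assumes "simple_graph E" "graph_connected E"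
  shows "num_spanning_trees E > 0"
  using assms rooted_forest_exists[of E "{undefined}"]
  by (simp add: num_spanning_trees_def spanning_trees_eq_rooted_forests[of _ undefined]
      graph_connected_iff_reaches[of _ undefined] card_gt_0_iff)

subsection \<open>Matrices with zero row and column sums\<close>

lemma matrix_diff_ldistrib: "A ** (B - C) = A ** B - A ** C" for A :: "'a::ring_1 ^ 'n ^ 'm"
  by (vector matrix_matrix_mult_def sum_subtractf[symmetric] right_diff_distrib)

lemma matrix_diff_rdistrib: "(A - B) ** C = A ** C - B ** C" for A :: "'a::ring_1 ^ 'n ^ 'm"
  by (vector matrix_matrix_mult_def sum_subtractf[symmetric] left_diff_distrib)

lemma matrix_add_rdistrib: "(A + B) ** C = A ** C + B ** C" for A :: "'a::semiring_1 ^ 'n ^ 'm"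
  by (vector matrix_matrix_mult_def sum.distrib[symmetric] distrib_right)

text \<open>Change to the basis in which \<open>e\<^sub>u\<close> is replaced by the all-ones vector \<open>1\<close> and every other
  \<open>e\<^sub>j\<close> by \<open>e\<^sub>j - 1/n\<close>, which is orthogonal to \<open>1\<close>; there the form splits into the
  two blocks \<open>c * n\<^sup>2\<close> and \<open>B(u | u)\<close>.\<close>

lemma det_add_const:
  fixes B :: "real^'n^'n"
  assumes rows: "\<And>i. (\<Sum>j\<in>UNIV. B $ i $ j) = 0" and cols: "\<And>j. (\<Sum>i\<in>UNIV. B $ i $ j) = 0"
  shows "det (\<chi> i j. B $ i $ j + c) = c * (real CARD('n))\<^sup>2 * principal_minor (- {u}) B"
proof -
  define n where "n = real CARD('n)"
  have [simp]: "n \<noteq> 0" by (simp add: n_def)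
  let ?N = "(\<chi> i j. B $ i $ j + c) :: real^'n^'n"
  \<comment> \<open>The base change is factored to make its determinant visibly 1: \<open>U\<close>
    puts ones in column \<open>u\<close>, and \<open>W\<close> then subtracts \<open>1 / n\<close>
    times column \<open>u\<close> from every other column.\<close>
  define U :: "real^'n^'n" where "U = (\<chi> i j. if j = u then 1 else if i = j then 1 else 0)"
  define W :: "real^'n^'n" where "W = (\<chi> i j. if i = u \<and> j \<noteq> u then - 1 / n else if i = j then 1 else 0)"
  define T where "T = U ** W"
  define M :: "real^'n^'n" where "M = (\<chi> i j. if j = u then c * n else B $ i $ j)"
  define R :: "real^'n^'n" where
    "R = (\<chi> i j. if i = u then (if j = u then c * n\<^sup>2 else 0) else if j = u then 0 else B $ i $ j)"
  have T: "T $ i $ j = (if j = u then 1 else (if i = j then 1 else 0) - 1 / n)" for i j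
  proof -
    have *: "T $ i $ j = (\<Sum>k\<in>UNIV. U $ i $ k * W $ k $ j)"
      by (simp add: T_def matrix_matrix_mult_def)
    show ?thesis
    proof (cases "j = u")
      case True
      note *
      also have "(\<Sum>k\<in>UNIV. U $ i $ k * W $ k $ j) = (\<Sum>k\<in>UNIV. if k = u then 1 else 0)"
        using True by (intro sum.cong) (auto simp: U_def W_def)
      finally show ?thesis using True by simp
    next
      case False
      note *
      also have "(\<Sum>k\<in>UNIV. U $ i $ k * W $ k $ j) =
          (\<Sum>k\<in>UNIV. (if k = j then (if i = j then 1 else 0) else 0) + (if k = u then - 1 / n else 0))"
        using False by (intro sum.cong) (auto simp: U_def W_def)
      finally show ?thesis using False by (simp add: sum.distrib)
    qed
  qed
  have NT: "?N ** T = M"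
  proof -
    have "(?N ** T) $ i $ j = M $ i $ j" for i j
    proof (cases "j = u")
      case True
      then show ?thesis
        using rows[of i] by (simp add: matrix_matrix_mult_def T M_def sum.distrib n_def)
    next
      case False
      have "(?N ** T) $ i $ j = (\<Sum>k\<in>UNIV. (if k = j then B $ i $ k + c else 0) - (B $ i $ k + c) / n)"
        unfolding matrix_matrix_mult_def using False by (auto simp: T algebra_simps add_divide_distrib intro!: sum.cong)
      also have "\<dots> = B $ i $ j + c - (\<Sum>k\<in>UNIV. B $ i $ k + c) / n"
        by (simp add: sum_subtractf sum_divide_distrib)
      also have "(\<Sum>k\<in>UNIV. B $ i $ k + c) = c * n"
        using rows[of i] by (simp add: sum.distrib n_def)
      finally show ?thesis using False by (simp add: M_def)
    qed
    then show ?thesis by (simp add: vec_eq_iff)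
  qed
  have TM: "transpose T ** M = R"
  proof -
    have M_sum: "(\<Sum>k\<in>UNIV. M $ k $ j) = (if j = u then c * n\<^sup>2 else 0)" for j
      using cols[of j] by (simp add: M_def n_def power2_eq_square)
    have "(transpose T ** M) $ i $ j = R $ i $ j" for i j
    proof (cases "i = u")
      case True
      then show ?thesis
        using M_sum[of j] by (simp add: matrix_matrix_mult_def transpose_def T R_def)
    next
      case False
      have "(transpose T ** M) $ i $ j = (\<Sum>k\<in>UNIV. (if k = i then M $ k $ j else 0) - M $ k $ j / n)"
        unfolding matrix_matrix_mult_def using False
        by (auto simp: T transpose_def algebra_simps intro!: sum.cong)
      also have "\<dots> = M $ i $ j - (\<Sum>k\<in>UNIV. M $ k $ j) / n"
        by (simp add: sum_subtractf sum_divide_distrib)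
      finally show ?thesis using False by (simp add: M_sum, simp add: M_def R_def power2_eq_square)
    qed
    then show ?thesis by (simp add: vec_eq_iff)
  qed
  \<comment> \<open>\<open>W\<close> and \<open>transpose U\<close> differ from the identity only in
    row \<open>u\<close>, so their determinants are their entries at \<open>(u, u)\<close>.\<close>
  have "det W = principal_minor {u} W"
    unfolding principal_minor_eq_det by (intro arg_cong[of _ _ det]) (auto simp: W_def vec_eq_iff)
  then have "det W = 1" by (simp add: principal_minor_singleton W_def)
  have "det U = principal_minor {u} (transpose U)"
    unfolding det_transpose[of U, symmetric] principal_minor_eq_det
    by (intro arg_cong[of _ _ det]) (auto simp: U_def transpose_def vec_eq_iff)
  then have "det U = 1" by (simp add: principal_minor_singleton U_def transpose_def)
  have "det T = 1" by (simp add: T_def det_mul \<open>det U = 1\<close> \<open>det W = 1\<close>)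
  then have "det ?N = det R"
    by (simp flip: TM NT add: det_mul)
  also have "\<dots> = det (\<chi> i. if i = u then (c * n\<^sup>2) *s axis u 1 else R $ i)"
    by (intro arg_cong[of _ _ det]) (auto simp: R_def axis_def vec_eq_iff)
  also have "\<dots> = c * n\<^sup>2 * det (\<chi> i. if i = u then axis u 1 else R $ i)"
    by (rule det_row_mul)
  also have "det (\<chi> i. if i = u then axis u 1 else R $ i) = principal_minor (- {u}) R"
    unfolding principal_minor_eq_det by (intro arg_cong[of _ _ det]) (auto simp: axis_def vec_eq_iff)
  also have "\<dots> = principal_minor (- {u}) B"
    by (rule principal_minor_cong) (auto simp: R_def)
  finally show ?thesis by (simp add: n_def)
qed

text \<open>Only columns \<open>u\<close> and \<open>v\<close> differ from the identity, so the
  transpose is the padded form of a two by two minor.\<close>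

lemma det_id_add_rank_one:
  fixes z :: "'n::finite \<Rightarrow> real"
  assumes "u \<noteq> v"
  shows "det ((\<chi> i j. (if i = j then 1 else 0) + z i * (of_bool (j = u) - of_bool (j = v))) :: real^'n^'n)
    = 1 + z u - z v" (is "det ?A = _")
proof -
  have "det ?A = principal_minor {u, v} (transpose ?A)"
    unfolding det_transpose[of ?A, symmetric] principal_minor_eq_det
    by (intro arg_cong[of _ _ det]) (auto simp: transpose_def vec_eq_iff)
  then show ?thesis
    using assms by (simp add: principal_minor_doubleton transpose_def algebra_simps)
qed

text \<open>With \<open>N = K + c J\<close> (\<open>J\<close> the all-ones matrix) and \<open>x = e\<^sub>u - e\<^sub>v\<close>, compute \<open>det (N + x x\<^sup>T)\<close> twice: by the
  matrix determinant lemma, and by \<open>det_add_const\<close>, since \<open>K + x x\<^sup>T\<close> still has zero row and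
  column sums and after deleting \<open>u\<close> differs from \<open>K\<close> only in the entry \<open>(v, v)\<close>.\<close>

lemma principal_minor_eq_inverse_quadratic_form:
  fixes K :: "real^'n^'n"
  assumes rows: "\<And>i. (\<Sum>j\<in>UNIV. K $ i $ j) = 0" and cols: "\<And>j. (\<Sum>i\<in>UNIV. K $ i $ j) = 0"
    and inv: "(\<chi> i j. K $ i $ j + c) ** P = mat 1" and "u \<noteq> v"
  shows "det (\<chi> i j. K $ i $ j + c) * (P $ u $ u - P $ u $ v - P $ v $ u + P $ v $ v) =
    c * (real CARD('n))\<^sup>2 * principal_minor (- {u, v}) K"
proof -
  let ?N = "(\<chi> i j. K $ i $ j + c) :: real^'n^'n"
  define x :: "'n \<Rightarrow> real" where "x j = of_bool (j = u) - of_bool (j = v)" for j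
  \<comment> \<open>As a vector, \<open>z\<close> is \<open>P x\<close>; since \<open>P\<close>
    inverts \<open>N\<close>, adding \<open>x x\<^sup>T\<close> to \<open>N\<close> amounts to
    multiplying \<open>N\<close> by the identity plus \<open>z x\<^sup>T\<close>.\<close>
  define z where "z i = P $ i $ u - P $ i $ v" for i
  define K' :: "real^'n^'n" where "K' = (\<chi> i j. K $ i $ j + x i * x j)"
  let ?N' = "(\<chi> i j. K' $ i $ j + c) :: real^'n^'n"
  let ?A = "(\<chi> i j. (if i = j then 1 else 0) + z i * x j) :: real^'n^'n"
  have x_sum: "(\<Sum>j\<in>UNIV. x j) = 0"
    by (simp add: x_def sum_subtractf of_bool_def)
  have N': "?N' = ?N ** ?A"
  proof -
    have "?N' $ i $ j = (?N ** ?A) $ i $ j" for i j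
    proof -
      have "(?N ** ?A) $ i $ j =
          (\<Sum>k\<in>UNIV. (if k = j then ?N $ i $ k else 0) + ?N $ i $ k * (P $ k $ u - P $ k $ v) * x j)"
        unfolding matrix_matrix_mult_def by (auto simp: z_def algebra_simps intro!: sum.cong)
      also have "\<dots> = ?N $ i $ j + (\<Sum>k\<in>UNIV. ?N $ i $ k * (P $ k $ u - P $ k $ v)) * x j"
        by (simp add: sum.distrib sum_distrib_right)
      also have "(\<Sum>k\<in>UNIV. ?N $ i $ k * (P $ k $ u - P $ k $ v)) = (?N ** P) $ i $ u - (?N ** P) $ i $ v"
        by (simp add: matrix_matrix_mult_def sum_subtractf right_diff_distrib)
      also have "\<dots> = x i"
        unfolding inv by (simp add: mat_def x_def)
      finally show ?thesis by (simp only: K'_def vec_lambda_beta)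
    qed
    then show ?thesis by (simp add: vec_eq_iff)
  qed
  have "det ?N' = det ?N * (1 + z u - z v)"
    using det_id_add_rank_one[OF \<open>u \<noteq> v\<close>, of z, folded x_def] by (simp only: N' det_mul)
  moreover have "det ?N' = c * (real CARD('n))\<^sup>2 * principal_minor (- {u}) K'"
  proof (rule det_add_const)
    show "(\<Sum>j\<in>UNIV. K' $ i $ j) = 0" for i
      using rows[of i] x_sum by (simp add: K'_def sum.distrib flip: sum_distrib_left)
    show "(\<Sum>i\<in>UNIV. K' $ i $ j) = 0" for j
      using cols[of j] x_sum by (simp add: K'_def sum.distrib flip: sum_distrib_right)
  qed
  moreover have "principal_minor (- {u}) K' =
      principal_minor (- {u}) K + 1 * principal_minor (- {u} - {v}) K"
    using \<open>u \<noteq> v\<close> by (intro principal_minor_add_diag) (auto simp: K'_def x_def)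
  moreover have "- {u} - {v} = - {u, v}" by auto
  moreover have "det ?N = c * (real CARD('n))\<^sup>2 * principal_minor (- {u}) K"
    using rows cols by (rule det_add_const)
  ultimately have "det ?N * (1 + z u - z v) =
      det ?N + c * (real CARD('n))\<^sup>2 * principal_minor (- {u, v}) K"
    by (simp add: algebra_simps)
  then show ?thesis by (simp add: z_def algebra_simps)
qed

subsection \<open>The pseudoinverse of the Laplacian\<close>

lemma laplacian_sym: "transpose (laplacian E) = laplacian E"
  by (auto simp: vec_eq_iff transpose_def laplacian_nth insert_commute)

lemma laplacian_row_sum:
  "simple_graph E \<Longrightarrow> (\<Sum>j\<in>UNIV. laplacian E $ i $ j) = 0"
  by (rule laplacian_sum_eq_0) auto

lemma laplacian_col_sum:
  assumes "simple_graph E"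
  shows "(\<Sum>i\<in>UNIV. laplacian E $ i $ j) = 0"
proof -
  have "laplacian E $ i $ j = laplacian E $ j $ i" for i
    by (simp add: laplacian_nth insert_commute)
  then show ?thesis using laplacian_row_sum[OF assms, of j] by simp
qed

text \<open>The orthogonal projection onto the constant vectors, on which the Laplacian of a simple
  graph vanishes.\<close>

definition avg_matrix :: "real^'n^'n" where
  "avg_matrix = (\<chi> i j. 1 / real CARD('n))"

lemma avg_matrix_idem: "avg_matrix ** avg_matrix = avg_matrix"
  by (simp add: avg_matrix_def matrix_matrix_mult_def vec_eq_iff)

lemma transpose_avg_matrix: "transpose avg_matrix = avg_matrix"
  by (simp add: avg_matrix_def transpose_def)

lemma laplacian_avg_matrix:
  assumes "simple_graph E"
  shows "laplacian E ** avg_matrix = 0" "avg_matrix ** laplacian E = 0"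
  using laplacian_row_sum[OF assms] laplacian_col_sum[OF assms]
  by (simp_all add: avg_matrix_def matrix_matrix_mult_def vec_eq_iff
      flip: sum_divide_distrib)

lemma det_laplacian_add_avg_matrix:
  fixes E :: "'v::finite set set"
  assumes "simple_graph E"
  shows "det (laplacian E + avg_matrix) = real CARD('v) * real (num_spanning_trees E)"
proof -
  have "laplacian E + avg_matrix = (\<chi> i j. laplacian E $ i $ j + 1 / real CARD('v))"
    by (simp add: avg_matrix_def vec_eq_iff)
  then show ?thesis
    using det_add_const[of "laplacian E" "1 / real CARD('v)" undefined]
      laplacian_row_sum[OF assms] laplacian_col_sum[OF assms]
    by (simp add: matrix_tree[OF assms] power2_eq_square)
qed

lemma inverse_mult_eq:
  fixes Q :: "real^'n^'n"
  assumes "Q ** M = mat 1" "M ** H = H"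
  shows "Q ** H = H"
  using assms by (metis matrix_mul_assoc matrix_mul_lid)

lemma mult_inverse_eq:
  fixes Q :: "real^'n^'n"
  assumes "M ** Q = mat 1" "H ** M = H"
  shows "H ** Q = H"
  using assms by (metis matrix_mul_assoc matrix_mul_rid)

text \<open>The inverse \<open>Q\<close> fixes \<open>avg_matrix\<close> because the sum it inverts
  does. Hence the Laplacian and \<open>Q - avg_matrix\<close> multiply in either order to the
  symmetric projection \<open>mat 1 - avg_matrix\<close>, which yields the Penrose
  conditions.\<close>

lemma moore_penrose_laplacian:
  fixes E :: "'v::finite set set"
  assumes E: "simple_graph E"
    and MQ: "(laplacian E + avg_matrix) ** Q = mat 1"
  shows "moore_penrose (laplacian E) = Q - avg_matrix"
    and "moore_penrose (laplacian E) ** moore_penrose (laplacian E) = Q ** Q - avg_matrix"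
proof -
  let ?L = "laplacian E" and ?H = "avg_matrix :: real^'v^'v"
  have QM: "Q ** (?L + ?H) = mat 1" using MQ by (simp add: matrix_left_right_inverse)
  note zero = laplacian_avg_matrix[OF E]
  have QH: "Q ** ?H = ?H"
    using QM by (rule inverse_mult_eq) (simp add: matrix_add_rdistrib zero avg_matrix_idem)
  have HQ: "?H ** Q = ?H"
    using MQ by (rule mult_inverse_eq) (simp add: matrix_add_ldistrib zero avg_matrix_idem)
  have LX: "?L ** (Q - ?H) = mat 1 - ?H"
    using MQ by (simp add: matrix_diff_ldistrib matrix_add_rdistrib zero HQ eq_diff_eq)
  have XL: "(Q - ?H) ** ?L = mat 1 - ?H"
    using QM by (simp add: matrix_diff_rdistrib matrix_add_ldistrib zero QH eq_diff_eq)
  have sym: "transpose (mat 1 - ?H) = mat 1 - ?H"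
    by (auto simp: vec_eq_iff transpose_def mat_def avg_matrix_def)
  have "is_moore_penrose ?L (Q - ?H)"
    unfolding is_moore_penrose_def LX XL
    by (simp add: sym matrix_diff_rdistrib matrix_diff_ldistrib zero HQ avg_matrix_idem)
  then show X: "moore_penrose ?L = Q - ?H"
    unfolding moore_penrose_def using is_moore_penrose_unique by blast
  show "moore_penrose ?L ** moore_penrose ?L = Q ** Q - ?H"
    by (simp add: X matrix_diff_rdistrib matrix_diff_ldistrib QH HQ avg_matrix_idem)
qed

theorem theorem3p5:
  fixes E :: "'v::finite set set" and u v :: 'v
  assumes "simple_graph E"
    and "graph_connected E"
    and "u \<noteq> v"
  shows "biharmonic_distance E u v =
    sqrt (det_deleted2 (laplacian E ** laplacian E) u v) /
    (sqrt (real CARD('v)) * real (num_spanning_trees E))"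
proof -
  let ?L = "laplacian E" and ?H = "avg_matrix :: real^'v^'v"
  define n \<tau> where "n = real CARD('v)" and "\<tau> = real (num_spanning_trees E)"
  have pos: "n > 0" "\<tau> > 0"
    using num_spanning_trees_pos[OF assms(1,2)] by (simp_all add: n_def \<tau>_def)
  define M where "M = ?L + ?H"
  define K where "K = ?L ** ?L"
  have det_M: "det M = n * \<tau>"
    using det_laplacian_add_avg_matrix[OF assms(1)] by (simp add: M_def n_def \<tau>_def)
  \<comment> \<open>Connectedness enters here: it makes the tree count positive and so
    \<open>M\<close> invertible.\<close>
  then have "det M \<noteq> 0" using pos by simp
  then obtain Q where Q: "M ** Q = mat 1" "Q ** M = mat 1"
    by (auto simp: invertible_det_nz[symmetric] invertible_def)
  have "transpose M = M"
    using laplacian_sym[of E] transpose_avg_matrix by (simp add: M_def transpose_def vec_eq_iff)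
  then have "transpose Q ** M = mat 1"
    using Q(1) by (metis matrix_transpose_mul transpose_mat)
  then have sym_Q: "transpose Q = Q"
    using Q(1) by (metis matrix_mul_assoc matrix_mul_lid matrix_mul_rid)
  define P where "P = Q ** Q"
  have sym_P: "P $ v $ u = P $ u $ v"
  proof -
    have "transpose P = P" by (simp add: P_def matrix_transpose_mul sym_Q)
    then have "transpose P $ u $ v = P $ u $ v" by simp
    then show ?thesis by (simp add: transpose_def)
  qed
  define d where "d = P $ u $ u + P $ v $ v - 2 * P $ u $ v"
  \<comment> \<open>The constant entries of \<open>avg_matrix\<close> cancel under the coefficients
    1, 1, -2, so \<open>P\<close> may replace the squared pseudoinverse.\<close>
  have "biharmonic_distance E u v = sqrt d"
    using moore_penrose_laplacian(2)[OF assms(1) Q(1)[unfolded M_def]]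
    by (simp add: biharmonic_distance_def d_def P_def avg_matrix_def)
  have KH: "K ** ?H = 0" "?H ** K = 0"
    using laplacian_avg_matrix[OF assms(1)]
    by (simp_all add: K_def matrix_mul_assoc flip: matrix_mul_assoc[of ?L ?L])
  have rows: "(\<Sum>j\<in>UNIV. K $ i $ j) = 0" for i
    using KH(1) by (simp add: matrix_matrix_mult_def avg_matrix_def vec_eq_iff flip: sum_divide_distrib)
  have cols: "(\<Sum>i\<in>UNIV. K $ i $ j) = 0" for j
    using KH(2) by (simp add: matrix_matrix_mult_def avg_matrix_def vec_eq_iff flip: sum_divide_distrib)
  have MM: "(\<chi> i j. K $ i $ j + 1 / real CARD('v)) = M ** M"
  proof -
    have "M ** M = K + ?H"
      using laplacian_avg_matrix[OF assms(1)]
      by (simp add: M_def K_def matrix_add_ldistrib matrix_add_rdistrib avg_matrix_idem)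
    then show ?thesis by (simp add: avg_matrix_def n_def vec_eq_iff)
  qed
  have "(M ** M) ** P = mat 1"
    using Q(1) unfolding P_def by (metis matrix_mul_assoc matrix_mul_rid)
  \<comment> \<open>With \<open>c = 1 / n\<close> the factor \<open>c * n * n\<close> is
    \<open>n\<close>, and symmetry of \<open>P\<close> merges the two mixed entries.\<close>
  then have "det (M ** M) * d = n * principal_minor (- {u, v}) K"
    using principal_minor_eq_inverse_quadratic_form[OF rows cols, of "1 / real CARD('v)" P u v] assms(3)
    by (simp add: MM d_def sym_P n_def power2_eq_square algebra_simps)
  then have "n * (n * \<tau>\<^sup>2 * d) = n * principal_minor (- {u, v}) K"
    by (simp add: det_mul det_M power2_eq_square mult_ac)
  then have "n * \<tau>\<^sup>2 * d = principal_minor (- {u, v}) K"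
    using pos by simp
  then have "n * \<tau>\<^sup>2 * d = det_deleted2 K u v"
    by (simp add: det_deleted2_def Compl_eq_Diff_UNIV)
  then have "d = det_deleted2 K u v / (n * \<tau>\<^sup>2)"
    using pos by (simp add: field_simps)
  then show ?thesis
    using \<open>biharmonic_distance E u v = sqrt d\<close> pos
    by (simp add: real_sqrt_divide real_sqrt_mult K_def flip: n_def \<tau>_def)
qed

end
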